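(* Fix $\tau_E$ and the energy $E^{\mathrm{EH,IC}*}(\tau_E)$ available to each of two devices. Consider the common rate maximization problem over $\{Q_k(t),\mathbf{q}_m(t)\}$ and $R$: maximize $R$ subject to $$\frac1T\int_{\tau_E}^T\log_2\left(1+\frac{\frac{Q_k(t)\beta_0}{\|\mathbf{q}_k(t)-\mathbf{w}_k\|^2+H^2}}{\frac{Q_{\bar k}(t)\beta_0}{\|\mathbf{q}_k(t)-\mathbf{w}_{\bar k}\|^2+H^2}+\sigma^2}\right)dt\ge R,\quad k\in\{1,2\},$$ $$\int_{\tau_E}^TQ_k(t)\,dt\le E^{\mathrm{EH,IC}*}(\tau_E),\quad k\in\{1,2\},$$ $$\|\mathbf{q}_1(t)-\mathbf{q}_2(t)\|^2\ge d_{\min}^2,\quad t\in(\tau_E,T],$$ where $\bar k$ is the element of $\{1,2\}$ other than $k$. Under each of the two transmission modes described in the context, the obtained solution to this problem is given as follows. Mode 1 (simultaneous transmission). The two UAVs should hover at two symmetric hovering locations, $\mathbf{q}_m^I(t)=\bar{\mathbf{q}}_m^{I*}=(\bar x_m^{I*},0)$ for $m\in\{1,2\}$ and $t\in(\tau_E,T]$ (with $\bar x_2^{I*}=-\bar x_1^{I*}$), and each device transmits with power $Q_k(t)=Q^{(1)}=E^{\mathrm{EH,IC}*}(\tau_E)/(T-\tau_E)$. Here the $\bar x_m^{I*}$ are obtained based on the equation $$\frac{(\bar x_1^{I*}+D/2)\left((\bar x_1^{I*}-D/2)^2+H^2\right)^2}{\beta_0Q^{(1)}/\sigma^2}-D\left(H^2+(D/2)^2-(\bar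 x_1^{I*})^2\right)=0,$$ with $$\max(D/2,d_{\min}/2)\le|\bar x_1^{I*}|\le\max\left(d_{\min}/2,\sqrt{(D/2)^2+H^2}\right).$$ Accordingly, the achievable common data-rate is, for both $k\in\{1,2\}$, $$R_k=R_{\mathrm{ST}}(\tau_E)=\frac{T-\tau_E}{T}\log_2\left(1+\frac{\frac{Q^{(1)}\beta_0}{(\bar x_k^{I*}-x_k)^2+H^2}}{\frac{Q^{(1)}\beta_0}{(\bar x_k^{I*}-x_{\bar k})^2+H^2}+\sigma^2}\right).$$ Mode 2 (TDMA transmission). Each device transmits over a half portion of the time interval $(\tau_E,T]$, and each UAV should hover exactly above its corresponding device during transmission: $\mathbf{q}_1^I(t)=\mathbf{w}_1$ for $t\in(\tau_E,T/2+\tau_E/2]$ and $\mathbf{q}_2^I(t)=\mathbf{w}_2$ for $t\in(T/2+\tau_E/2,T]$. The transmit powers are $Q_1(t)=Q^{(2)}=2E^{\mathrm{EH,IC}*}(\tau_E)/(T-\tau_E)$, $Q_2(t)=0$ for $t\in(\tau_E,T/2+\tau_E/2]$, and $Q_1(t)=0$, $Q_2(t)=Q^{(2)}$ for $t\in(T/2+\tau_E/2,T]$. Accordingly, the achievable common data-rate is, for both $k\in\{1,2\}$, $$R_k=R_{\mathrm{TDMA}}(\tau_E)=\frac{T-\tau_E}{2T}\log_2\left(1+\frac{Q^{(2)}\beta_0/\sigma^2}{H^2}\right).$$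
   Context: Two UAVs fly at fixed altitude $H>0$ with horizontal positions $\mathbf{q}_1(t),\mathbf{q}_2(t)\in\mathbb{R}^2$. Two ground devices, at distance $D$ from each other, have horizontal positions $\mathbf{w}_k=(x_k,0)$ with $x_1=-D/2$ and $x_2=D/2$. The mission duration is $T$; the UAVs charge the devices wirelessly during $(0,\tau_E]$, and during $(\tau_E,T]$ device $k$ sends information to UAV $k$ with transmit power $Q_k(t)$, the other device's signal acting as interference. $\beta_0$ is the channel power gain at reference distance 1 m, $\sigma^2$ the noise power at each UAV receiver, and $d_{\min}$ the minimum inter-UAV distance for collision avoidance. $E^{\mathrm{EH,IC}*}(\tau_E)$ is the (equal) amount of energy harvested by each device during $(0,\tau_E]$; here it is a given number. $R_k$ denotes the rate of device $k$ (the left-hand side of the first constraint). The superscript $I$ marks UAV locations used for information transfer. The "obtained solution" is sought as follows: the UAVs are taken to hover at fixed locations during information transfer, and binary power control is used, in which the two devices either transmit simultaneously (Mode 1) or transmit in a time-division (TDMA) manner (Mode 2), with full power. In Mode 1 the UAVs hover at symmetric locations $(\bar x_1^I,0)$ and $(-\bar x_1^I,0)$ with $|\bar x_1^I|\ge d_{\min}/2$, and $\bar x_1^I$ is chosen to maximize $$\frac{T-\tau_E}{T}\log_2\left(1+\frac{\frac{Q^{(1)}\beta_0}{(\bar x_1^I+D/2)^2+H^2}}{\frac{Q^{(1)}\beta_0}{(\bar x_1^I-D/2)^2+H^2}+\sigma^2}\right).$$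
   Formalization: In the Mode 1 equation the second term has sign + instead of − (as printed, no maximizer solves it when d_min is small); x̄_1 is negative, and if the equation has no negative root in the stated range, then |x̄_1| = d_min/2. *)

theory Defs
  imports "HOL-Analysis.Analysis"
begin

text \<open>
  Parameters, in this order wherever they occur: altitude \<open>H\<close>, device distance \<open>D\<close>,
  reference channel gain \<open>\<beta>\<close>, noise power \<open>\<sigma>\<^sup>2\<close>, minimum UAV distance \<open>dmin\<close>, duration \<open>T\<close>,
  end of the charging phase \<open>\<tau>\<close>, harvested energy \<open>E\<close> per device.  Devices and UAVs are indexed
  by \<open>k \<in> {1,2}\<close>; only these two indices are ever used.  The norm of \<open>real \<times> real\<close> is the
  Euclidean one.
\<close>

definition other :: "nat \<Rightarrow> nat" where
  "other k = 3 - k"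

definition dev_x :: "real \<Rightarrow> nat \<Rightarrow> real" where
  "dev_x D k = (if k = 1 then - D / 2 else D / 2)"

definition dev :: "real \<Rightarrow> nat \<Rightarrow> real \<times> real" where
  "dev D k = (dev_x D k, 0)"

definition inst_rate ::
  "real \<Rightarrow> real \<Rightarrow> real \<Rightarrow> real \<Rightarrow> (nat \<Rightarrow> real \<Rightarrow> real) \<Rightarrow> (nat \<Rightarrow> real \<Rightarrow> real \<times> real)
    \<Rightarrow> nat \<Rightarrow> real \<Rightarrow> real" where
  "inst_rate H D \<beta> \<sigma> Q q k t =
     log 2 (1 + (Q k t * \<beta> / ((norm (q k t - dev D k))\<^sup>2 + H\<^sup>2)) /
                (Q (other k) t * \<beta> / ((norm (q k t - dev D (other k)))\<^sup>2 + H\<^sup>2) + \<sigma>\<^sup>2))"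

definition rate ::
  "real \<Rightarrow> real \<Rightarrow> real \<Rightarrow> real \<Rightarrow> real \<Rightarrow> real
    \<Rightarrow> (nat \<Rightarrow> real \<Rightarrow> real) \<Rightarrow> (nat \<Rightarrow> real \<Rightarrow> real \<times> real) \<Rightarrow> nat \<Rightarrow> real" where
  "rate H D \<beta> \<sigma> T \<tau> Q q k = 1 / T * integral {\<tau><..T} (inst_rate H D \<beta> \<sigma> Q q k)"

text \<open>Powers are nonnegative, and all integrals in the constraints are required to exist
  (\<open>integral\<close> is \<open>0\<close> for a function that is not integrable).\<close>

definition feasible ::
  "real \<Rightarrow> real \<Rightarrow> real \<Rightarrow> real \<Rightarrow> real \<Rightarrow> real \<Rightarrow> real \<Rightarrow> real
    \<Rightarrow> (nat \<Rightarrow> real \<Rightarrow> real) \<Rightarrow> (nat \<Rightarrow> real \<Rightarrow> real \<times> real) \<Rightarrow> real \<Rightarrow> bool" where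
  "feasible H D \<beta> \<sigma> dmin T \<tau> E Q q R \<longleftrightarrow>
     (\<forall>k\<in>{1,2}.
        (\<forall>t\<in>{\<tau><..T}. 0 \<le> Q k t) \<and>
        Q k integrable_on {\<tau><..T} \<and>
        inst_rate H D \<beta> \<sigma> Q q k integrable_on {\<tau><..T} \<and>
        rate H D \<beta> \<sigma> T \<tau> Q q k \<ge> R \<and>
        integral {\<tau><..T} (Q k) \<le> E) \<and>
     (\<forall>t\<in>{\<tau><..T}. (norm (q 1 t - q 2 t))\<^sup>2 \<ge> dmin\<^sup>2)"

text \<open>Binary power control: a device is either silent or uses its own fixed power level.  The level
  is a free variable of the problem, limited only by the energy constraint.\<close>

definition binary_power :: "real \<Rightarrow> real \<Rightarrow> (nat \<Rightarrow> real \<Rightarrow> real) \<Rightarrow> bool" where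
  "binary_power T \<tau> Q \<longleftrightarrow> (\<forall>k\<in>{1,2}. \<exists>p>0. \<forall>t\<in>{\<tau><..T}. Q k t \<in> {0, p})"

text \<open>Mode 1: both devices transmit all the time, with the UAVs hovering at symmetric locations.
  The bound \<open>\<bar>x\<bar> \<ge> dmin / 2\<close> is what the collision constraint in \<open>feasible\<close> amounts to here.\<close>

definition mode1 ::
  "real \<Rightarrow> real \<Rightarrow> (nat \<Rightarrow> real \<Rightarrow> real) \<Rightarrow> (nat \<Rightarrow> real \<Rightarrow> real \<times> real) \<Rightarrow> bool" where
  "mode1 T \<tau> Q q \<longleftrightarrow>
     binary_power T \<tau> Q \<and>
     (\<forall>t\<in>{\<tau><..T}. Q 1 t \<noteq> 0 \<and> Q 2 t \<noteq> 0) \<and>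
     (\<exists>x. \<forall>t\<in>{\<tau><..T}. q 1 t = (x, 0) \<and> q 2 t = (- x, 0))"

text \<open>Mode 2: the devices never transmit at the same time.  How the time is divided is left open, and
  a UAV has to hover at a fixed location only while its own device transmits.\<close>

definition mode2 ::
  "real \<Rightarrow> real \<Rightarrow> (nat \<Rightarrow> real \<Rightarrow> real) \<Rightarrow> (nat \<Rightarrow> real \<Rightarrow> real \<times> real) \<Rightarrow> bool" where
  "mode2 T \<tau> Q q \<longleftrightarrow>
     binary_power T \<tau> Q \<and>
     (\<forall>t\<in>{\<tau><..T}. Q 1 t = 0 \<or> Q 2 t = 0) \<and>
     (\<forall>k\<in>{1,2}. \<exists>u. \<forall>t\<in>{\<tau><..T}. Q k t \<noteq> 0 \<longrightarrow> q k t = u)"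

text \<open>Solutions of the common rate maximization problem restricted to a transmission mode \<open>M\<close>.\<close>

definition solution_in ::
  "(real \<Rightarrow> real \<Rightarrow> (nat \<Rightarrow> real \<Rightarrow> real) \<Rightarrow> (nat \<Rightarrow> real \<Rightarrow> real \<times> real) \<Rightarrow> bool)
    \<Rightarrow> real \<Rightarrow> real \<Rightarrow> real \<Rightarrow> real \<Rightarrow> real \<Rightarrow> real \<Rightarrow> real \<Rightarrow> real
    \<Rightarrow> (nat \<Rightarrow> real \<Rightarrow> real) \<Rightarrow> (nat \<Rightarrow> real \<Rightarrow> real \<times> real) \<Rightarrow> real \<Rightarrow> bool" where
  "solution_in M H D \<beta> \<sigma> dmin T \<tau> E Q q R \<longleftrightarrow>
     M T \<tau> Q q \<and> feasible H D \<beta> \<sigma> dmin T \<tau> E Q q R \<and>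
     (\<forall>Q' q' R'. M T \<tau> Q' q' \<and> feasible H D \<beta> \<sigma> dmin T \<tau> E Q' q' R' \<longrightarrow> R' \<le> R)"

definition power1 :: "real \<Rightarrow> real \<Rightarrow> real \<Rightarrow> real" where
  "power1 T \<tau> E = E / (T - \<tau>)"

definition power2 :: "real \<Rightarrow> real \<Rightarrow> real \<Rightarrow> real" where
  "power2 T \<tau> E = 2 * E / (T - \<tau>)"

definition mode1_objective ::
  "real \<Rightarrow> real \<Rightarrow> real \<Rightarrow> real \<Rightarrow> real \<Rightarrow> real \<Rightarrow> real \<Rightarrow> real \<Rightarrow> real" where
  "mode1_objective H D \<beta> \<sigma> T \<tau> E x =
     (T - \<tau>) / T *
       log 2 (1 + (power1 T \<tau> E * \<beta> / ((x + D / 2)\<^sup>2 + H\<^sup>2)) /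
                  (power1 T \<tau> E * \<beta> / ((x - D / 2)\<^sup>2 + H\<^sup>2) + \<sigma>\<^sup>2))"

text \<open>The location \<open>x\<close> of UAV 1 maximizes the objective subject to the collision constraint.\<close>

definition mode1_optimal_x ::
  "real \<Rightarrow> real \<Rightarrow> real \<Rightarrow> real \<Rightarrow> real \<Rightarrow> real \<Rightarrow> real \<Rightarrow> real \<Rightarrow> real \<Rightarrow> bool" where
  "mode1_optimal_x H D \<beta> \<sigma> dmin T \<tau> E x \<longleftrightarrow>
     is_arg_max (mode1_objective H D \<beta> \<sigma> T \<tau> E) (\<lambda>x. \<bar>x\<bar> \<ge> dmin / 2) x"

text \<open>
  The stationarity condition of \<open>mode1_objective\<close>.  The second summand carries a plus sign: the
  derivative at \<open>x\<close> is a negative multiple of the left-hand side.  With a minus sign there would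
  be no solution with \<open>x < 0\<close> and \<open>D / 2 \<le> \<bar>x\<bar> \<le> sqrt ((D / 2)\<^sup>2 + H\<^sup>2)\<close>, because the first summand
  would be nonpositive, the bracket nonnegative, and not both zero; yet maximizers are negative
  (UAV 1 is on the side of device 1, located at \<open>- D / 2\<close>).
\<close>

definition mode1_equation ::
  "real \<Rightarrow> real \<Rightarrow> real \<Rightarrow> real \<Rightarrow> real \<Rightarrow> real \<Rightarrow> real \<Rightarrow> real \<Rightarrow> bool" where
  "mode1_equation H D \<beta> \<sigma> T \<tau> E x \<longleftrightarrow>
     (x + D / 2) * ((x - D / 2)\<^sup>2 + H\<^sup>2)\<^sup>2 / (\<beta> * power1 T \<tau> E / \<sigma>\<^sup>2)
       + D * (H\<^sup>2 + (D / 2)\<^sup>2 - x\<^sup>2) = 0"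

definition mode1_range :: "real \<Rightarrow> real \<Rightarrow> real \<Rightarrow> real \<Rightarrow> bool" where
  "mode1_range H D dmin x \<longleftrightarrow>
     max (D / 2) (dmin / 2) \<le> \<bar>x\<bar> \<and> \<bar>x\<bar> \<le> max (dmin / 2) (sqrt ((D / 2)\<^sup>2 + H\<^sup>2))"

definition uav_x :: "real \<Rightarrow> nat \<Rightarrow> real" where
  "uav_x x k = (if k = 1 then x else - x)"

definition R_ST ::
  "real \<Rightarrow> real \<Rightarrow> real \<Rightarrow> real \<Rightarrow> real \<Rightarrow> real \<Rightarrow> real \<Rightarrow> real \<Rightarrow> nat \<Rightarrow> real" where
  "R_ST H D \<beta> \<sigma> T \<tau> E x k =
     (T - \<tau>) / T *
       log 2 (1 + (power1 T \<tau> E * \<beta> / ((uav_x x k - dev_x D k)\<^sup>2 + H\<^sup>2)) /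
                  (power1 T \<tau> E * \<beta> / ((uav_x x k - dev_x D (other k))\<^sup>2 + H\<^sup>2) + \<sigma>\<^sup>2))"

definition R_TDMA :: "real \<Rightarrow> real \<Rightarrow> real \<Rightarrow> real \<Rightarrow> real \<Rightarrow> real \<Rightarrow> real" where
  "R_TDMA H \<beta> \<sigma> T \<tau> E =
     (T - \<tau>) / (2 * T) * log 2 (1 + (power2 T \<tau> E * \<beta> / \<sigma>\<^sup>2) / H\<^sup>2)"

definition mode1_scheme ::
  "real \<Rightarrow> real \<Rightarrow> real \<Rightarrow> real \<Rightarrow> (nat \<Rightarrow> real \<Rightarrow> real) \<Rightarrow> (nat \<Rightarrow> real \<Rightarrow> real \<times> real) \<Rightarrow> bool" where
  "mode1_scheme T \<tau> E x Q q \<longleftrightarrow>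
     (\<forall>t\<in>{\<tau><..T}. \<forall>k\<in>{1,2}. Q k t = power1 T \<tau> E \<and> q k t = (uav_x x k, 0))"

text \<open>The location of a UAV is prescribed only while its device transmits; outside that slot it only
  has to respect the collision constraint (for \<open>dmin > D\<close> it cannot stay above its device).\<close>

definition mode2_scheme ::
  "real \<Rightarrow> real \<Rightarrow> real \<Rightarrow> real \<Rightarrow> real \<Rightarrow> (nat \<Rightarrow> real \<Rightarrow> real) \<Rightarrow> (nat \<Rightarrow> real \<Rightarrow> real \<times> real)
    \<Rightarrow> bool" where
  "mode2_scheme D dmin T \<tau> E Q q \<longleftrightarrow>
     (\<forall>t\<in>{\<tau><..T / 2 + \<tau> / 2}. Q 1 t = power2 T \<tau> E \<and> Q 2 t = 0 \<and> q 1 t = dev D 1) \<and>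
     (\<forall>t\<in>{T / 2 + \<tau> / 2<..T}. Q 1 t = 0 \<and> Q 2 t = power2 T \<tau> E \<and> q 2 t = dev D 2) \<and>
     (\<forall>t\<in>{\<tau><..T}. (norm (q 1 t - q 2 t))\<^sup>2 \<ge> dmin\<^sup>2)"

end

theory Submission
  imports Defs
begin

text \<open>
  Mode 1: the reciprocal of the SINR of device 1 is \<open>A / B + \<kappa> * A\<close> with \<open>A = (x + D/2)\<^sup>2 + H\<^sup>2\<close>,
  \<open>B = (x - D/2)\<^sup>2 + H\<^sup>2\<close> and \<open>\<kappa> = \<sigma>\<^sup>2 / (\<beta> Q)\<close>.  Its derivative is \<open>2 / B\<^sup>2\<close> times the left-hand side
  of the stationarity equation, which is negative for \<open>x \<le> - sqrt ((D/2)\<^sup>2 + H\<^sup>2)\<close>, strictly increasing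
  for \<open>x \<le> - D/2\<close> and positive on \<open>[- D/2, 0]\<close>.  Hence it has a single negative root \<open>x\<^sub>0\<close>, and since a
  positive \<open>x\<close> is always worse than \<open>- x\<close>, the maximizer is \<open>min x\<^sub>0 (- dmin / 2)\<close>.  Unequal powers
  cannot help, because the device with the smaller power has a smaller rate than under equal powers.

  Mode 2: when only one device transmits at a time, the sum of the two instantaneous rates is at most
  \<open>log 2 (1 + c * (Q\<^sub>1 + Q\<^sub>2))\<close> with \<open>c = \<beta> / (\<sigma>\<^sup>2 H\<^sup>2)\<close>.  Bounding the logarithm by its tangent at
  \<open>power2\<close> and integrating, the energy constraints bound the sum of the rates by \<open>2 * R_TDMA\<close>.
\<close>

section \<open>The reciprocal SINR of Mode 1: derivative, sign changes and constrained
  minimum\<close>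

definition stat_fun :: "real \<Rightarrow> real \<Rightarrow> real \<Rightarrow> real \<Rightarrow> real" where
  "stat_fun H D \<kappa> x =
     \<kappa> * (x + D / 2) * ((x - D / 2)\<^sup>2 + H\<^sup>2)\<^sup>2 + D * (H\<^sup>2 + (D / 2)\<^sup>2 - x\<^sup>2)"

definition inv_sinr :: "real \<Rightarrow> real \<Rightarrow> real \<Rightarrow> real \<Rightarrow> real" where
  "inv_sinr H D \<kappa> x =
     ((x + D / 2)\<^sup>2 + H\<^sup>2) / ((x - D / 2)\<^sup>2 + H\<^sup>2) + \<kappa> * ((x + D / 2)\<^sup>2 + H\<^sup>2)"

lemma sq_plus_sq_pos: "H > 0 \<Longrightarrow> x\<^sup>2 + H\<^sup>2 > (0::real)"
  by (simp add: add_nonneg_pos)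

lemma inv_sinr_pos:
  assumes "H > 0" and "\<kappa> > 0"
  shows "inv_sinr H D \<kappa> x > 0"
  unfolding inv_sinr_def using assms sq_plus_sq_pos[of H] by (simp add: add_pos_pos)

text \<open>In the numerator of the quotient rule the cubic terms in \<open>x\<close> cancel,
  leaving \<open>2 * D * K\<close> with \<open>K = H\<^sup>2 + (D / 2)\<^sup>2 - x\<^sup>2\<close>.
  Factoring \<open>2 / B\<^sup>2\<close> out of this and of the linear term from
  \<open>\<kappa> * A\<close> leaves \<open>stat_fun\<close>.\<close>

lemma inv_sinr_deriv:
  assumes "H > 0"
  shows "(inv_sinr H D \<kappa> has_real_derivative
           2 / ((x - D / 2)\<^sup>2 + H\<^sup>2)\<^sup>2 * stat_fun H D \<kappa> x) (at x)"
proof -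
  have nz: "(x - D / 2)\<^sup>2 + H\<^sup>2 \<noteq> 0"
    using sq_plus_sq_pos[OF assms, of "x - D / 2"] by (rule less_imp_neq[symmetric])
  have "(inv_sinr H D \<kappa> has_real_derivative
      (2 * (x + D / 2) * ((x - D / 2)\<^sup>2 + H\<^sup>2) - ((x + D / 2)\<^sup>2 + H\<^sup>2) * (2 * (x - D / 2)))
        / (((x - D / 2)\<^sup>2 + H\<^sup>2) * ((x - D / 2)\<^sup>2 + H\<^sup>2)) + \<kappa> * (2 * (x + D / 2))) (at x)"
    unfolding inv_sinr_def[abs_def] by (rule derivative_eq_intros refl nz | simp)+
  moreover have "(2 * (x + D / 2) * B - ((x + D / 2)\<^sup>2 + H\<^sup>2) * (2 * (x - D / 2))) / (B * B)
        + \<kappa> * (2 * (x + D / 2)) = 2 / B\<^sup>2 * stat_fun H D \<kappa> x"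
    if "B = (x - D / 2)\<^sup>2 + H\<^sup>2" for B
  proof -
    have "B \<noteq> 0" using nz that by simp
    define K where "K = H\<^sup>2 + (D / 2)\<^sup>2 - x\<^sup>2"
    have num: "2 * (x + D / 2) * B - ((x + D / 2)\<^sup>2 + H\<^sup>2) * (2 * (x - D / 2))
        = 2 * D * K"
      unfolding that K_def by (simp add: power2_eq_square field_simps)
    then show ?thesis
      unfolding stat_fun_def that[symmetric] num K_def[symmetric] using \<open>B \<noteq> 0\<close>
      by (simp add: field_simps power2_eq_square)
  qed
  ultimately show ?thesis by simp
qed

text \<open>Moving right towards \<open>- D / 2\<close> shrinks both \<open>- x - D / 2\<close> and
  \<open>(x - D / 2)\<^sup>2\<close>, so the negated first summand does not grow. Strictness comes
  from the term \<open>- D * x\<^sup>2\<close>.\<close>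

lemma stat_fun_strict_mono:
  assumes "H > 0" and "D > 0" and "\<kappa> > 0" and "x < y" and "y \<le> - D / 2"
  shows "stat_fun H D \<kappa> x < stat_fun H D \<kappa> y"
proof -
  define X where "X = (x - D / 2)\<^sup>2 + H\<^sup>2"
  define Y where "Y = (y - D / 2)\<^sup>2 + H\<^sup>2"
  have sq: "y\<^sup>2 < x\<^sup>2"
    using assms power_strict_mono[of "- y" "- x" 2] by simp
  have "(y - D / 2)\<^sup>2 \<le> (x - D / 2)\<^sup>2"
    using assms by (simp add: abs_le_square_iff[symmetric])
  then have "Y\<^sup>2 \<le> X\<^sup>2"
    unfolding X_def Y_def by (intro power_mono) auto
  then have "(- y - D / 2) * Y\<^sup>2 \<le> (- x - D / 2) * X\<^sup>2"
    using assms by (intro mult_mono) auto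
  then have "\<kappa> * ((- y - D / 2) * Y\<^sup>2) \<le> \<kappa> * ((- x - D / 2) * X\<^sup>2)"
    using assms by simp
  moreover have "D * y\<^sup>2 < D * x\<^sup>2" using sq assms by simp
  ultimately show ?thesis
    unfolding stat_fun_def X_def[symmetric] Y_def[symmetric] by (simp add: algebra_simps)
qed

lemma stat_fun_pos:
  assumes "H > 0" and "D > 0" and "\<kappa> > 0" and "- D / 2 \<le> x" and "x \<le> 0"
  shows "stat_fun H D \<kappa> x > 0"
proof -
  have "x\<^sup>2 \<le> (D / 2)\<^sup>2" using assms by (intro power2_le_iff_abs_le[THEN iffD2]) auto
  moreover have "H\<^sup>2 > 0" using assms by simp
  ultimately have "H\<^sup>2 + (D / 2)\<^sup>2 - x\<^sup>2 > 0" by linarith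
  then show ?thesis
    unfolding stat_fun_def using assms by (intro add_nonneg_pos mult_nonneg_nonneg) auto
qed

text \<open>At \<open>- sqrt ((D / 2)\<^sup>2 + H\<^sup>2)\<close> the second summand vanishes and
  the first is nonpositive; at \<open>- D / 2\<close> the first vanishes and the second is positive.
  The intermediate value theorem gives a root between them, and these endpoints are the source of
  the bounds in \<open>mode1_range\<close>.\<close>

lemma stat_fun_root:
  assumes "H > 0" and "D > 0" and "\<kappa> > 0"
  obtains x0 where "- sqrt ((D / 2)\<^sup>2 + H\<^sup>2) \<le> x0" and "x0 < - D / 2" and "stat_fun H D \<kappa> x0 = 0"
proof -
  define r where "r = sqrt ((D / 2)\<^sup>2 + H\<^sup>2)"
  have r2: "r\<^sup>2 = (D / 2)\<^sup>2 + H\<^sup>2" unfolding r_def by simp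
  have r: "D / 2 < r"
    unfolding r_def using assms by (intro real_less_rsqrt) simp
  have "stat_fun H D \<kappa> (- r) \<le> 0"
  proof -
    have "\<kappa> * (- r + D / 2) * ((- r - D / 2)\<^sup>2 + H\<^sup>2)\<^sup>2 \<le> 0"
      using r assms by (intro mult_nonpos_nonneg mult_nonneg_nonpos) auto
    then show ?thesis unfolding stat_fun_def using r2 by simp
  qed
  moreover have pos: "0 < stat_fun H D \<kappa> (- D / 2)"
    using assms by (intro stat_fun_pos) auto
  moreover have "continuous_on {- r .. - D / 2} (stat_fun H D \<kappa>)"
    unfolding stat_fun_def[abs_def] by (intro continuous_intros)
  ultimately obtain x0 where x0: "- r \<le> x0" "x0 \<le> - D / 2" "stat_fun H D \<kappa> x0 = 0"
    using IVT'[of "stat_fun H D \<kappa>" "- r" 0 "- D / 2"] r by auto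
  moreover have "x0 \<noteq> - D / 2" using pos x0 by auto
  ultimately show thesis using that unfolding r_def by fastforce
qed

text \<open>The unconstrained minimizer \<open>x0\<close> is pushed to the half line up to
  \<open>- m\<close> when it violates the constraint. The strict inequality later yields uniqueness
  of the optimal location.\<close>

lemma inv_sinr_minimum:
  assumes "H > 0" and "D > 0" and "\<kappa> > 0" and "m \<ge> 0"
    and x0: "x0 < - D / 2" "stat_fun H D \<kappa> x0 = 0"
    and "\<bar>y\<bar> \<ge> m" and "y \<noteq> min x0 (- m)"
  shows "inv_sinr H D \<kappa> (min x0 (- m)) < inv_sinr H D \<kappa> y"
proof -
  note deriv = inv_sinr_deriv[OF assms(1), of D \<kappa>]
  have B: "2 / ((x - D / 2)\<^sup>2 + H\<^sup>2)\<^sup>2 > 0" for x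
    by (intro divide_pos_pos zero_less_power sq_plus_sq_pos[OF assms(1)]) simp
  have cont: "continuous_on S (inv_sinr H D \<kappa>)" for S
    using deriv by (meson DERIV_isCont continuous_at_imp_continuous_on)
  have dec: "inv_sinr H D \<kappa> b < inv_sinr H D \<kappa> a" if "a < b" "b \<le> x0" for a b
  proof (rule DERIV_neg_imp_decreasing_open[OF that(1) _ cont])
    fix z assume z: "a < z" "z < b"
    have "stat_fun H D \<kappa> z < 0"
      using stat_fun_strict_mono[OF assms(1-3), of z x0] z that x0 by simp
    then show "\<exists>y. (inv_sinr H D \<kappa> has_real_derivative y) (at z) \<and> y < 0"
      using deriv[of z] B[of z] mult_pos_neg by blast
  qed
  have inc: "inv_sinr H D \<kappa> a < inv_sinr H D \<kappa> b" if "a < b" "x0 \<le> a" "b \<le> 0" for a b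
  proof (rule DERIV_pos_imp_increasing_open[OF that(1) _ cont])
    fix z assume z: "a < z" "z < b"
    have "stat_fun H D \<kappa> z > 0"
    proof (cases "z \<le> - D / 2")
      case True
      then show ?thesis using stat_fun_strict_mono[OF assms(1-3), of x0 z] z that x0 by simp
    next
      case False
      then show ?thesis using stat_fun_pos[OF assms(1-3), of z] z that by simp
    qed
    then show "\<exists>y. (inv_sinr H D \<kappa> has_real_derivative y) (at z) \<and> y > 0"
      using deriv[of z] B[of z] mult_pos_pos by blast
  qed
  have nonpos: "inv_sinr H D \<kappa> (min x0 (- m)) < inv_sinr H D \<kappa> z"
    if "z \<le> - m" "z \<noteq> min x0 (- m)" for z
  proof (cases "z < min x0 (- m)")
    case True
    then show ?thesis using dec by simp
  next
    case False
    \<comment> \<open>Here \<open>z\<close> exceeds the minimum but not \<open>- m\<close>, so the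
      minimum must be \<open>x0\<close>, and \<open>inv_sinr\<close> increases from there up to
      \<open>0\<close>.\<close>
    then show ?thesis using that inc[of "min x0 (- m)" z] \<open>m \<ge> 0\<close> by (auto simp: min_def split: if_splits)
  qed
  show ?thesis
  proof (cases "y \<le> 0")
    case True
    then show ?thesis using nonpos[of y] assms by simp
  next
    case False
    \<comment> \<open>For \<open>y > 0\<close>, passing to \<open>- y\<close> exchanges the squared
      distances \<open>A > B\<close>; this lowers both summands of \<open>inv_sinr\<close>.\<close>
    define A where "A = (y + D / 2)\<^sup>2 + H\<^sup>2"
    define B where "B = (- y + D / 2)\<^sup>2 + H\<^sup>2"
    have AB: "A > B" "B > 0"
      using False assms mult_pos_pos[of y D] unfolding A_def B_def
      by (simp_all add: power2_eq_square algebra_simps add_nonneg_pos sum_squares_gt_zero_iff)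
         (use sq_plus_sq_pos[OF assms(1), of "- y + D / 2"] in \<open>simp add: power2_eq_square algebra_simps\<close>)
    have eqs: "(y - D / 2)\<^sup>2 + H\<^sup>2 = B" "(- y - D / 2)\<^sup>2 + H\<^sup>2 = A"
      unfolding A_def B_def by (simp_all add: power2_eq_square algebra_simps)
    have "B / A < 1" "1 < A / B" using AB by simp_all
    then have "B / A < A / B" by linarith
    then have "B / A + \<kappa> * B < A / B + \<kappa> * A"
      using AB assms(3) by (intro add_strict_mono mult_strict_left_mono) auto
    then have "inv_sinr H D \<kappa> (- y) < inv_sinr H D \<kappa> y"
      unfolding inv_sinr_def eqs A_def[symmetric] B_def[symmetric] .
    moreover have "inv_sinr H D \<kappa> (min x0 (- m)) \<le> inv_sinr H D \<kappa> (- y)"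
      using nonpos[of "- y"] False assms by (cases "- y = min x0 (- m)") auto
    ultimately show ?thesis by linarith
  qed
qed

section \<open>The optimal hovering location of Mode 1\<close>

lemma sinr_eq_inverse_inv_sinr:
  assumes "H > 0" and "p > 0" and "\<beta> > 0" and "\<sigma> > 0"
  shows "(p * \<beta> / ((x + D / 2)\<^sup>2 + H\<^sup>2)) / (p * \<beta> / ((x - D / 2)\<^sup>2 + H\<^sup>2) + \<sigma>\<^sup>2)
    = 1 / inv_sinr H D (\<sigma>\<^sup>2 / (\<beta> * p)) x"
proof -
  define A where "A = (x + D / 2)\<^sup>2 + H\<^sup>2"
  define B where "B = (x - D / 2)\<^sup>2 + H\<^sup>2"
  have pos: "A > 0" "B > 0" "p * \<beta> > 0" "\<sigma>\<^sup>2 > 0"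
    unfolding A_def B_def using assms sq_plus_sq_pos[OF assms(1)] by simp_all
  have "A / B + \<sigma>\<^sup>2 / (\<beta> * p) * A = (p * \<beta> / B + \<sigma>\<^sup>2) / (p * \<beta> / A)"
    using pos assms by (simp add: field_simps power2_eq_square)
  then show ?thesis
    unfolding inv_sinr_def A_def[symmetric] B_def[symmetric] by simp
qed

text \<open>The objective depends on \<open>x\<close> only through the SINR, as a strictly
  increasing function of it; taking reciprocals reverses the order. Maximizing the objective thus
  becomes minimizing \<open>inv_sinr\<close>.\<close>

lemma mode1_objective_less_iff:
  assumes "H > 0" and "\<beta> > 0" and "\<sigma> > 0" and "0 \<le> \<tau>" and "\<tau> < T" and "E > 0"
  shows "mode1_objective H D \<beta> \<sigma> T \<tau> E x < mode1_objective H D \<beta> \<sigma> T \<tau> E y \<longleftrightarrow>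
    inv_sinr H D (\<sigma>\<^sup>2 / (\<beta> * power1 T \<tau> E)) y < inv_sinr H D (\<sigma>\<^sup>2 / (\<beta> * power1 T \<tau> E)) x"
proof -
  define \<kappa> where "\<kappa> = \<sigma>\<^sup>2 / (\<beta> * power1 T \<tau> E)"
  have p: "power1 T \<tau> E > 0" using assms by (simp add: power1_def)
  then have "\<kappa> > 0" unfolding \<kappa>_def using assms by simp
  then have pos: "inv_sinr H D \<kappa> z > 0" for z using inv_sinr_pos assms by blast
  have "(T - \<tau>) / T > 0" using assms by simp
  moreover have "1 + 1 / inv_sinr H D \<kappa> z > 0" for z using pos[of z] by (simp add: add_pos_pos)
  moreover have "1 / inv_sinr H D \<kappa> x < 1 / inv_sinr H D \<kappa> y \<longleftrightarrow> inv_sinr H D \<kappa> y < inv_sinr H D \<kappa> x"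
    using pos[of x] pos[of y] by (simp add: divide_simps)
  ultimately show ?thesis
    unfolding mode1_objective_def sinr_eq_inverse_inv_sinr[OF assms(1) p assms(2,3)]
      \<kappa>_def[symmetric]
    by (simp only: mult_less_cancel_left_pos) simp
qed

lemma mode1_equation_iff:
  assumes "\<beta> > 0" and "\<sigma> > 0"
  shows "mode1_equation H D \<beta> \<sigma> T \<tau> E x \<longleftrightarrow> stat_fun H D (\<sigma>\<^sup>2 / (\<beta> * power1 T \<tau> E)) x = 0"
  unfolding mode1_equation_def stat_fun_def by (simp add: mult_ac)

text \<open>The two alternatives correspond to whether the root \<open>x0\<close> respects the
  collision constraint. If it does, it is the optimum; if not, the equation has no negative solution
  in the range and the optimum is the boundary point \<open>- (dmin / 2)\<close>.\<close>

lemma mode1_optimal_x_characterization: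
  assumes "H > 0" and "D > 0" and "\<beta> > 0" and "\<sigma> > 0" and "dmin \<ge> 0"
    and "0 \<le> \<tau>" and "\<tau> < T" and "E > 0"
  shows "(\<exists>!x. mode1_optimal_x H D \<beta> \<sigma> dmin T \<tau> E x) \<and>
     (\<forall>x. mode1_optimal_x H D \<beta> \<sigma> dmin T \<tau> E x \<longleftrightarrow>
        x < 0 \<and> mode1_range H D dmin x \<and>
        (mode1_equation H D \<beta> \<sigma> T \<tau> E x \<or>
         \<bar>x\<bar> = dmin / 2 \<and>
         \<not> (\<exists>y<0. mode1_range H D dmin y \<and> mode1_equation H D \<beta> \<sigma> T \<tau> E y)))"
proof -
  define \<kappa> where "\<kappa> = \<sigma>\<^sup>2 / (\<beta> * power1 T \<tau> E)"
  have \<kappa>: "\<kappa> > 0" unfolding \<kappa>_def using assms by (simp add: power1_def)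
  obtain x0 where x0: "- sqrt ((D / 2)\<^sup>2 + H\<^sup>2) \<le> x0" "x0 < - D / 2" "stat_fun H D \<kappa> x0 = 0"
    using stat_fun_root[OF assms(1,2) \<kappa>] .
  define xs where "xs = min x0 (- (dmin / 2))"
  have less: "mode1_objective H D \<beta> \<sigma> T \<tau> E y < mode1_objective H D \<beta> \<sigma> T \<tau> E xs"
    if "\<bar>y\<bar> \<ge> dmin / 2" "y \<noteq> xs" for y
    using inv_sinr_minimum[OF assms(1,2) \<kappa> _ x0(2,3) that(1)] that(2) assms(5)
    unfolding mode1_objective_less_iff[OF assms(1,3,4,6,7,8)] \<kappa>_def[symmetric] xs_def by simp
  have feas: "\<bar>xs\<bar> \<ge> dmin / 2" unfolding xs_def by linarith
  have opt: "mode1_optimal_x H D \<beta> \<sigma> dmin T \<tau> E x \<longleftrightarrow> x = xs" for x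
    unfolding mode1_optimal_x_def is_arg_max_def using less feas by (metis less_asym)
  have root: "y = x0" if "y \<le> - D / 2" "stat_fun H D \<kappa> y = 0" for y
    using stat_fun_strict_mono[OF assms(1,2) \<kappa>, of y x0]
      stat_fun_strict_mono[OF assms(1,2) \<kappa>, of x0 y] that x0
    by (cases y x0 rule: linorder_cases) auto
  \<comment> \<open>A negative point of the range lies at or left of \<open>- D / 2\<close>, where
    \<open>x0\<close> is the only root.\<close>
  have eq_iff: "mode1_equation H D \<beta> \<sigma> T \<tau> E y \<longleftrightarrow> y = x0"
    if "y < 0" "mode1_range H D dmin y" for y
    using that root[of y] x0(3) mode1_equation_iff[OF assms(3,4)]
    unfolding mode1_range_def \<kappa>_def by auto
  have range0: "mode1_range H D dmin x0 \<longleftrightarrow> dmin / 2 \<le> - x0"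
    using x0 assms(2) unfolding mode1_range_def by auto
  have char: "x < 0 \<and> mode1_range H D dmin x \<and>
        (mode1_equation H D \<beta> \<sigma> T \<tau> E x \<or>
         \<bar>x\<bar> = dmin / 2 \<and>
         \<not> (\<exists>y<0. mode1_range H D dmin y \<and> mode1_equation H D \<beta> \<sigma> T \<tau> E y)) \<longleftrightarrow> x = xs" for x
  proof (cases "dmin / 2 \<le> - x0")
    case True
    then have "xs = x0" unfolding xs_def by simp
    then show ?thesis using True range0 eq_iff x0(2) assms(2) by force
  next
    case False
    then have xs: "xs = - (dmin / 2)" "xs < 0" unfolding xs_def using x0(2) assms(2) by auto
    have "mode1_range H D dmin xs"
      \<comment> \<open>Now \<open>dmin / 2 > - x0 > D / 2\<close>, so \<open>dmin / 2\<close>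
        dominates the lower bound of the range, and the upper bound is at least
        \<open>dmin / 2\<close>.\<close>
      using False x0(2) assms(2) unfolding mode1_range_def xs by auto
    then show ?thesis using False range0 eq_iff xs by (smt (verit, ccfv_threshold))
  qed
  show ?thesis unfolding opt char by simp
qed

section \<open>Integrals of step functions over half-open intervals\<close>

lemma has_integral_const_Ioc:
  fixes f :: "real \<Rightarrow> real"
  assumes "a \<le> b" and "\<And>t. t \<in> {a<..b} \<Longrightarrow> f t = c"
  shows "(f has_integral (b - a) * c) {a<..b}"
proof -
  have "((\<lambda>t. c) has_integral (b - a) * c) {a..b}"
    using has_integral_const_real[of c a b] assms(1) by simp
  \<comment> \<open>Dropping the endpoint \<open>a\<close> changes the domain only by a null
    set.\<close>
  then have "((\<lambda>t. c) has_integral (b - a) * c) {a<..b}"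
    by (rule has_integral_spike_set_eq[THEN iffD1, rotated 2])
      (auto intro: negligible_subset[OF negligible_sing[of a]])
  then show ?thesis by (rule has_integral_eq[rotated]) (simp add: assms(2))
qed

lemma has_integral_two_step_Ioc:
  fixes f :: "real \<Rightarrow> real"
  assumes "a \<le> m" and "m \<le> b"
    and "\<And>t. t \<in> {a<..m} \<Longrightarrow> f t = c" and "\<And>t. t \<in> {m<..b} \<Longrightarrow> f t = d"
  shows "(f has_integral (m - a) * c + (b - m) * d) {a<..b}"
proof -
  have "(f has_integral (m - a) * c + (b - m) * d) ({a<..m} \<union> {m<..b})"
    using assms by (intro has_integral_Un has_integral_const_Ioc) auto
  then show ?thesis using assms by (simp add: ivl_disj_un)
qed

section \<open>Optimality of the Mode 1 scheme\<close>

lemma other_simps [simp]: "other (Suc 0) = 2" "other 2 = Suc 0"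
  by (simp_all add: other_def)

lemma norm_real_pair_sq: "(norm ((x, y) :: real \<times> real))\<^sup>2 = x\<^sup>2 + y\<^sup>2"
  by (simp add: norm_Pair)

text \<open>Reflection in the origin swaps the two devices and the two UAVs, so neither rate depends
  on the index.\<close>

lemma R_ST_eq_mode1_objective:
  assumes "k \<in> {1, 2}"
  shows "R_ST H D \<beta> \<sigma> T \<tau> E x k = mode1_objective H D \<beta> \<sigma> T \<tau> E x"
proof -
  have "(- x - D / 2)\<^sup>2 = (x + D / 2)\<^sup>2" "(- x + D / 2)\<^sup>2 = (x - D / 2)\<^sup>2"
    by (simp_all add: power2_eq_square algebra_simps)
  then show ?thesis
    using assms unfolding R_ST_def mode1_objective_def uav_x_def dev_x_def by auto
qed

lemma inst_rate_hover:
  assumes "q 1 t = (x, 0)" and "q 2 t = (- x, 0)" and "k \<in> {1, 2}"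
  shows "inst_rate H D \<beta> \<sigma> Q q k t =
    log 2 (1 + (Q k t * \<beta> / ((x + D / 2)\<^sup>2 + H\<^sup>2)) /
      (Q (other k) t * \<beta> / ((x - D / 2)\<^sup>2 + H\<^sup>2) + \<sigma>\<^sup>2))"
proof -
  have "(- x - D / 2)\<^sup>2 = (x + D / 2)\<^sup>2" "(- x + D / 2)\<^sup>2 = (x - D / 2)\<^sup>2"
    by (simp_all add: power2_eq_square algebra_simps)
  then show ?thesis
    using assms unfolding inst_rate_def dev_def dev_x_def
    by (auto simp: norm_real_pair_sq other_def)
qed

text \<open>Here \<open>p\<close> is the power of the weaker device, \<open>p'\<close> that of its
  interferer and \<open>s\<close> a common power. Lowering the interferer to \<open>p\<close> helps,
  and then raising both powers to \<open>s\<close> helps again.\<close>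

lemma log_sinr_mono:
  assumes "H > 0" and "\<beta> > 0" and "\<sigma> > 0" and "0 < p" and "p \<le> p'" and "p \<le> s"
  shows "log 2 (1 + (p * \<beta> / ((x + D / 2)\<^sup>2 + H\<^sup>2)) / (p' * \<beta> / ((x - D / 2)\<^sup>2 + H\<^sup>2) + \<sigma>\<^sup>2))
    \<le> log 2 (1 + (s * \<beta> / ((x + D / 2)\<^sup>2 + H\<^sup>2)) / (s * \<beta> / ((x - D / 2)\<^sup>2 + H\<^sup>2) + \<sigma>\<^sup>2))"
proof -
  define A where "A = (x + D / 2)\<^sup>2 + H\<^sup>2"
  define B where "B = (x - D / 2)\<^sup>2 + H\<^sup>2"
  have pos: "A > 0" "B > 0" "\<sigma>\<^sup>2 > 0"
    unfolding A_def B_def using assms sq_plus_sq_pos[OF assms(1)] by simp_all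
  have den: "r * \<beta> / B + \<sigma>\<^sup>2 > 0" if "r > 0" for r
    using that pos assms by (simp add: add_pos_pos)
  have "(p * \<beta> / A) / (p' * \<beta> / B + \<sigma>\<^sup>2) \<le> (p * \<beta> / A) / (p * \<beta> / B + \<sigma>\<^sup>2)"
    using den[of p] pos assms by (intro divide_left_mono) (auto simp: divide_right_mono intro!: mult_pos_pos den)
  also have "\<dots> \<le> (s * \<beta> / A) / (s * \<beta> / B + \<sigma>\<^sup>2)"
  proof -
    \<comment> \<open>Dividing through by the common power \<open>r\<close> leaves it only in the
      relative noise \<open>\<sigma>\<^sup>2 / r\<close>, which decreases in
      \<open>r\<close>.\<close>
    have eq: "(r * \<beta> / A) / (r * \<beta> / B + \<sigma>\<^sup>2) = (\<beta> / A) / (\<beta> / B + \<sigma>\<^sup>2 / r)" if "r > 0" for r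
      using that pos assms den[OF that] by (simp add: field_simps)
    have "s > 0" using assms by simp
    show ?thesis
      unfolding eq[OF \<open>0 < p\<close>] eq[OF \<open>s > 0\<close>] using pos assms \<open>s > 0\<close>
      by (intro divide_left_mono mult_pos_pos add_pos_pos add_left_mono) auto
  qed
  finally have "(p * \<beta> / A) / (p' * \<beta> / B + \<sigma>\<^sup>2) \<le> (s * \<beta> / A) / (s * \<beta> / B + \<sigma>\<^sup>2)" .
  moreover have "0 < (p * \<beta> / A) / (p' * \<beta> / B + \<sigma>\<^sup>2)"
    using den[of p'] pos assms by simp
  ultimately show ?thesis
    unfolding A_def[symmetric] B_def[symmetric] by (subst log_le_cancel_iff) auto
qed

lemma mode1_upper_bound:
  assumes "H > 0" and "D > 0" and "\<beta> > 0" and "\<sigma> > 0" and "dmin \<ge> 0"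
    and "0 \<le> \<tau>" and "\<tau> < T" and "E > 0"
    and mode: "mode1 T \<tau> Q q" and feas: "feasible H D \<beta> \<sigma> dmin T \<tau> E Q q R"
  obtains x where "\<bar>x\<bar> \<ge> dmin / 2" and "R \<le> mode1_objective H D \<beta> \<sigma> T \<tau> E x"
proof -
  have T: "T \<in> {\<tau><..T}" using assms by simp
  obtain x where x: "\<And>t. t \<in> {\<tau><..T} \<Longrightarrow> q 1 t = (x, 0) \<and> q 2 t = (- x, 0)"
    using mode unfolding mode1_def by auto
  \<comment> \<open>Two power levels of which \<open>0\<close> is never taken leave a constant
    power.\<close>
  have "\<exists>p. p > 0 \<and> (\<forall>t\<in>{\<tau><..T}. Q k t = p)" if "k \<in> {1, 2}" for k
    using mode that unfolding mode1_def binary_power_def by fastforce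
  then have "\<forall>k\<in>{1, 2}. \<exists>p. p > 0 \<and> (\<forall>t\<in>{\<tau><..T}. Q k t = p)" by blast
  then obtain p where "\<forall>k\<in>{1, 2}. p k > 0 \<and> (\<forall>t\<in>{\<tau><..T}. Q k t = p k)"
    by (rule bchoice[THEN exE])
  then have p: "\<And>k. k \<in> {1, 2} \<Longrightarrow> p k > 0"
      "\<And>k t. k \<in> {1, 2} \<Longrightarrow> t \<in> {\<tau><..T} \<Longrightarrow> Q k t = p k"
    by blast+
  have "(norm ((x, 0) - (- x, 0) :: real \<times> real))\<^sup>2 \<ge> dmin\<^sup>2"
    using feas x[OF T] T unfolding feasible_def by metis
  then have "dmin\<^sup>2 \<le> (2 * x)\<^sup>2" by (simp add: norm_real_pair_sq)
  then have feas_x: "\<bar>x\<bar> \<ge> dmin / 2"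
    using assms(5) unfolding abs_le_square_iff[symmetric] by simp
  have le: "p k \<le> power1 T \<tau> E" if "k \<in> {1, 2}" for k
  proof -
    have "integral {\<tau><..T} (Q k) = (T - \<tau>) * p k"
      using assms p[OF that] by (intro integral_unique has_integral_const_Ioc) auto
    moreover have "integral {\<tau><..T} (Q k) \<le> E" using feas that unfolding feasible_def by blast
    ultimately show ?thesis using assms unfolding power1_def by (simp add: field_simps)
  qed
  \<comment> \<open>The common rate is at most the rate of each device, so it suffices to bound that
    of the device with the smaller power.\<close>
  obtain k where k: "k \<in> {1, 2}" "p k \<le> p (other k)"
    using linear[of "p 1" "p 2"] that[of 1] that[of 2] by auto
  have k': "other k \<in> {1, 2}" using k by auto
  define L where "L = log 2 (1 + (p k * \<beta> / ((x + D / 2)\<^sup>2 + H\<^sup>2)) /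
      (p (other k) * \<beta> / ((x - D / 2)\<^sup>2 + H\<^sup>2) + \<sigma>\<^sup>2))"
  have "inst_rate H D \<beta> \<sigma> Q q k t = L" if "t \<in> {\<tau><..T}" for t
    using inst_rate_hover[of q t x k] x[OF that] p(2)[OF k(1) that] p(2)[OF k' that] k(1)
    unfolding L_def by simp
  then have "integral {\<tau><..T} (inst_rate H D \<beta> \<sigma> Q q k) = (T - \<tau>) * L"
    using assms by (intro integral_unique has_integral_const_Ioc) auto
  then have "R \<le> (T - \<tau>) / T * L"
    using feas k(1) unfolding feasible_def rate_def by fastforce
  also have "\<dots> \<le> mode1_objective H D \<beta> \<sigma> T \<tau> E x"
    unfolding mode1_objective_def L_def using assms p(1)[OF k(1)] k(2) le[OF k(1)]
    by (intro mult_left_mono log_sinr_mono) auto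
  finally show thesis using that feas_x by blast
qed

lemma mode1_scheme_solution:
  assumes "H > 0" and "D > 0" and "\<beta> > 0" and "\<sigma> > 0" and "dmin \<ge> 0"
    and "0 \<le> \<tau>" and "\<tau> < T" and "E > 0"
    and opt: "mode1_optimal_x H D \<beta> \<sigma> dmin T \<tau> E x" and scheme: "mode1_scheme T \<tau> E x Q q"
    and k: "k \<in> {1, 2}"
  shows "rate H D \<beta> \<sigma> T \<tau> Q q k = R_ST H D \<beta> \<sigma> T \<tau> E x k"
    and "solution_in mode1 H D \<beta> \<sigma> dmin T \<tau> E Q q (R_ST H D \<beta> \<sigma> T \<tau> E x k)"
proof -
  let ?R = "mode1_objective H D \<beta> \<sigma> T \<tau> E x"
  have p: "power1 T \<tau> E > 0" using assms by (simp add: power1_def)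
  have Q: "Q j t = power1 T \<tau> E" if "j \<in> {1, 2}" "t \<in> {\<tau><..T}" for j t
    using scheme that unfolding mode1_scheme_def by blast
  have q: "q 1 t = (x, 0)" "q 2 t = (- x, 0)" if "t \<in> {\<tau><..T}" for t
    using scheme that unfolding mode1_scheme_def uav_x_def by auto
  have Qint: "(Q j has_integral E) {\<tau><..T}" if "j \<in> {1, 2}" for j
    using has_integral_const_Ioc[of \<tau> T "Q j" "power1 T \<tau> E"] Q[OF that] assms
    by (simp add: power1_def)
  have rint: "(inst_rate H D \<beta> \<sigma> Q q j has_integral T * ?R) {\<tau><..T}" if "j \<in> {1, 2}" for j
  proof -
    have j': "other j \<in> {1, 2}" using that by auto
    have "T * ?R = (T - \<tau>) * log 2 (1 + (power1 T \<tau> E * \<beta> / ((x + D / 2)\<^sup>2 + H\<^sup>2)) /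
        (power1 T \<tau> E * \<beta> / ((x - D / 2)\<^sup>2 + H\<^sup>2) + \<sigma>\<^sup>2))"
      unfolding mode1_objective_def using assms by simp
    moreover have "inst_rate H D \<beta> \<sigma> Q q j t = log 2 (1 + (power1 T \<tau> E * \<beta> / ((x + D / 2)\<^sup>2 + H\<^sup>2)) /
        (power1 T \<tau> E * \<beta> / ((x - D / 2)\<^sup>2 + H\<^sup>2) + \<sigma>\<^sup>2))" if t: "t \<in> {\<tau><..T}" for t
      unfolding inst_rate_hover[where q = q, OF q(1)[OF t] q(2)[OF t] \<open>j \<in> {1, 2}\<close>]
        Q[OF \<open>j \<in> {1, 2}\<close> t] Q[OF j' t] ..
    ultimately show ?thesis using has_integral_const_Ioc assms by simp
  qed
  have rate: "rate H D \<beta> \<sigma> T \<tau> Q q j = ?R" if "j \<in> {1, 2}" for j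
    unfolding rate_def integral_unique[OF rint[OF that]] using assms by simp
  show "rate H D \<beta> \<sigma> T \<tau> Q q k = R_ST H D \<beta> \<sigma> T \<tau> E x k"
    unfolding rate[OF k] R_ST_eq_mode1_objective[OF k] ..
  have x: "dmin / 2 \<le> \<bar>x\<bar>"
    "\<And>y. dmin / 2 \<le> \<bar>y\<bar> \<Longrightarrow> mode1_objective H D \<beta> \<sigma> T \<tau> E y \<le> ?R"
    using opt unfolding mode1_optimal_x_def is_arg_max_def by (auto simp: not_less)
  have "dmin\<^sup>2 \<le> (2 * x)\<^sup>2"
    using x(1) assms(5) unfolding abs_le_square_iff[symmetric] by simp
  then have "dmin\<^sup>2 \<le> (norm (q 1 t - q 2 t))\<^sup>2" if "t \<in> {\<tau><..T}" for t
    unfolding q[OF that] by (simp add: norm_real_pair_sq)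
  then have feas: "feasible H D \<beta> \<sigma> dmin T \<tau> E Q q ?R"
    unfolding feasible_def using Q p Qint rint rate
    by (auto simp: less_imp_le has_integral_iff)
  have mode: "mode1 T \<tau> Q q"
    unfolding mode1_def binary_power_def
    using Q p q by (intro conjI ballI) (auto intro: exI[where x = "power1 T \<tau> E"] exI[where x = x])
  show "solution_in mode1 H D \<beta> \<sigma> dmin T \<tau> E Q q (R_ST H D \<beta> \<sigma> T \<tau> E x k)"
    unfolding solution_in_def R_ST_eq_mode1_objective[OF k]
    \<comment> \<open>A competitor is bounded by the objective at its own location, which satisfies
      the collision constraint and hence does no better than \<open>x\<close>.\<close>
    using mode feas by (auto elim!: mode1_upper_bound[OF assms(1-8)] dest: x(2) order_trans)
qed

section \<open>The TDMA bound and optimality of the Mode 2 scheme\<close>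

lemma inst_rate_le:
  assumes "H > 0" and "\<beta> > 0" and "\<sigma> > 0" and "Q k t \<ge> 0" and "Q (other k) t \<ge> 0"
  shows "inst_rate H D \<beta> \<sigma> Q q k t \<le> log 2 (1 + \<beta> / (\<sigma>\<^sup>2 * H\<^sup>2) * Q k t)"
proof -
  define A where "A = (norm (q k t - dev D k))\<^sup>2 + H\<^sup>2"
  define I where "I = Q (other k) t * \<beta> / ((norm (q k t - dev D (other k)))\<^sup>2 + H\<^sup>2)"
  have A: "H\<^sup>2 \<le> A" "H\<^sup>2 > 0" "A > 0" and I: "I \<ge> 0" and \<sigma>: "\<sigma>\<^sup>2 > 0"
    unfolding A_def I_def using assms sq_plus_sq_pos[OF assms(1)] by simp_all
  have nonneg: "0 \<le> Q k t * \<beta> / A / (I + \<sigma>\<^sup>2)"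
    using A I \<sigma> assms by (intro divide_nonneg_nonneg mult_nonneg_nonneg) auto
  \<comment> \<open>The squared distance to the device is at least \<open>H\<^sup>2\<close>, and the
    interference \<open>I\<close> can only enlarge the denominator.\<close>
  have "Q k t * \<beta> / A / (I + \<sigma>\<^sup>2) \<le> Q k t * \<beta> / H\<^sup>2 / \<sigma>\<^sup>2"
    using A I \<sigma> assms by (intro frac_le divide_left_mono) auto
  also have "\<dots> = \<beta> / (\<sigma>\<^sup>2 * H\<^sup>2) * Q k t" by (simp add: mult_ac)
  finally show ?thesis
    unfolding inst_rate_def A_def[symmetric] I_def[symmetric] using nonneg by simp
qed

text \<open>Concavity of the logarithm. The tangent is affine in \<open>y\<close>, so after
  integration the power enters only through its integral, which the energy constraint
  controls.\<close>

lemma log_tangent_le: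
  fixes c p y :: real
  assumes "c > 0" and "p > 0" and "y \<ge> 0"
  shows "log 2 (1 + c * y) \<le> log 2 (1 + c * p) + c / ((1 + c * p) * ln 2) * (y - p)"
proof -
  have pos: "1 + c * p > 0" "1 + c * y > 0" using assms by (simp_all add: add_pos_nonneg)
  have "ln (1 + c * y) - ln (1 + c * p) \<le> ((1 + c * y) - (1 + c * p)) / (1 + c * p)"
    using ln_diff_le pos by blast
  also have "\<dots> = c / (1 + c * p) * (y - p)" by (simp add: algebra_simps)
  finally have "(ln (1 + c * y) - ln (1 + c * p)) / ln 2 \<le> c / (1 + c * p) * (y - p) / ln 2"
    by (intro divide_right_mono) auto
  then show ?thesis unfolding log_def by (simp add: diff_divide_distrib)
qed

lemma mode2_upper_bound:
  assumes "H > 0" and "\<beta> > 0" and "\<sigma> > 0"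
    and "0 \<le> \<tau>" and "\<tau> < T" and "E > 0"
    and mode: "mode2 T \<tau> Q q" and feas: "feasible H D \<beta> \<sigma> dmin T \<tau> E Q q R"
  shows "R \<le> R_TDMA H \<beta> \<sigma> T \<tau> E"
proof -
  define c where "c = \<beta> / (\<sigma>\<^sup>2 * H\<^sup>2)"
  define p where "p = power2 T \<tau> E"
  define \<mu> where "\<mu> = c / ((1 + c * p) * ln 2)"
  define L where "L = log 2 (1 + c * p)"
  let ?r = "\<lambda>k. inst_rate H D \<beta> \<sigma> Q q k"
  have pos: "c > 0" "p > 0" unfolding c_def p_def power2_def using assms by simp_all
  have \<mu>: "\<mu> \<ge> 0" unfolding \<mu>_def using pos by (simp add: add_pos_pos)
  have int: "Q k integrable_on {\<tau><..T}" "?r k integrable_on {\<tau><..T}"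
      "integral {\<tau><..T} (Q k) \<le> E" "R \<le> rate H D \<beta> \<sigma> T \<tau> Q q k"
      "\<And>t. t \<in> {\<tau><..T} \<Longrightarrow> Q k t \<ge> 0" if "k \<in> {1, 2}" for k
    using feas that unfolding feasible_def by auto
  have bound: "?r 1 t + ?r 2 t \<le> (L - \<mu> * p) + \<mu> * (Q 1 t + Q 2 t)" if t: "t \<in> {\<tau><..T}" for t
  proof -
    have Q: "Q 1 t \<ge> 0" "Q 2 t \<ge> 0" "Q 1 t = 0 \<or> Q 2 t = 0"
      using int(5) t mode unfolding mode2_def by auto
    have "?r 1 t \<le> log 2 (1 + c * Q 1 t)" "?r 2 t \<le> log 2 (1 + c * Q 2 t)"
      unfolding c_def using Q assms by (intro inst_rate_le; simp)+
    \<comment> \<open>The silent device contributes \<open>log 2 1 = 0\<close>, so the sum of the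
      two bounds is the bound at the total power.\<close>
    then have "?r 1 t + ?r 2 t \<le> log 2 (1 + c * (Q 1 t + Q 2 t))"
      using Q(3) by auto
    also have "\<dots> \<le> L + \<mu> * (Q 1 t + Q 2 t - p)"
      unfolding L_def \<mu>_def using log_tangent_le pos Q by simp
    finally show ?thesis by (simp add: algebra_simps)
  qed
  have "((\<lambda>t. ?r 1 t + ?r 2 t) has_integral
      integral {\<tau><..T} (?r 1) + integral {\<tau><..T} (?r 2)) {\<tau><..T}"
    using int by (intro has_integral_add integrable_integral) auto
  moreover have "((\<lambda>t. (L - \<mu> * p) + \<mu> * (Q 1 t + Q 2 t)) has_integral (T - \<tau>) * (L - \<mu> * p)
      + \<mu> * (integral {\<tau><..T} (Q 1) + integral {\<tau><..T} (Q 2))) {\<tau><..T}"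
    using int assms
    by (intro has_integral_add has_integral_mult_right integrable_integral has_integral_const_Ioc) auto
  ultimately have "integral {\<tau><..T} (?r 1) + integral {\<tau><..T} (?r 2)
      \<le> (T - \<tau>) * (L - \<mu> * p) + \<mu> * (integral {\<tau><..T} (Q 1) + integral {\<tau><..T} (Q 2))"
    by (rule has_integral_le) (rule bound)
  also have "\<dots> \<le> (T - \<tau>) * (L - \<mu> * p) + \<mu> * (E + E)"
    using int(3) \<mu> by (intro add_left_mono mult_left_mono add_mono) auto
  \<comment> \<open>Since \<open>(T - \<tau>) * p = 2 * E\<close>, the terms with
    \<open>\<mu>\<close> cancel; this is why the tangent is taken at \<open>power2\<close>.\<close>
  also have "\<dots> = (T - \<tau>) * L"
    unfolding p_def power2_def using assms by (simp add: field_simps)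
  finally have sum: "integral {\<tau><..T} (?r 1) + integral {\<tau><..T} (?r 2) \<le> (T - \<tau>) * L" .
  have "T * R \<le> integral {\<tau><..T} (?r k)" if "k \<in> {1, 2}" for k
    using int(4)[OF that] assms unfolding rate_def by (simp add: field_simps)
  from this[of 1] this[of 2] sum have "2 * T * R \<le> (T - \<tau>) * L" by simp
  then have "R \<le> (T - \<tau>) / (2 * T) * L" using assms by (simp add: field_simps)
  also have "L = log 2 (1 + (power2 T \<tau> E * \<beta> / \<sigma>\<^sup>2) / H\<^sup>2)"
    unfolding L_def c_def p_def by (simp add: mult_ac)
  finally show ?thesis unfolding R_TDMA_def .
qed

lemma mode2_scheme_exists: "\<exists>Q q. mode2_scheme D dmin T \<tau> E Q q"
proof (intro exI)
  let ?Q = "\<lambda>k t. if (k = 1) = (t \<le> T / 2 + \<tau> / 2) then power2 T \<tau> E else 0"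
  \<comment> \<open>The idle UAV is offset by \<open>(dmin, 0)\<close> from the transmitting one in
    each slot, so the squared distance is exactly \<open>dmin\<^sup>2\<close>.\<close>
  let ?q = "\<lambda>k t. if t \<le> T / 2 + \<tau> / 2
      then (if k = 1 then dev D 1 else dev D 1 + (dmin, 0))
      else (if k = (2::nat) then dev D 2 else dev D 2 + (dmin, 0))"
  show "mode2_scheme D dmin T \<tau> E ?Q ?q"
    unfolding mode2_scheme_def by auto
qed

lemma mode2_scheme_solution:
  assumes "H > 0" and "\<beta> > 0" and "\<sigma> > 0"
    and "0 \<le> \<tau>" and "\<tau> < T" and "E > 0" and scheme: "mode2_scheme D dmin T \<tau> E Q q"
  shows "\<forall>k\<in>{1,2}. rate H D \<beta> \<sigma> T \<tau> Q q k = R_TDMA H \<beta> \<sigma> T \<tau> E"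
    and "solution_in mode2 H D \<beta> \<sigma> dmin T \<tau> E Q q (R_TDMA H \<beta> \<sigma> T \<tau> E)"
proof -
  define m where "m = T / 2 + \<tau> / 2"
  define p where "p = power2 T \<tau> E"
  define L where "L = log 2 (1 + (p * \<beta> / \<sigma>\<^sup>2) / H\<^sup>2)"
  have m: "\<tau> \<le> m" "m \<le> T" "m - \<tau> = (T - \<tau>) / 2" "T - m = (T - \<tau>) / 2"
    unfolding m_def using assms by (simp_all add: field_simps)
  have p: "p > 0" "(T - \<tau>) * p = 2 * E" unfolding p_def power2_def using assms by simp_all
  have slot1: "Q 1 t = p" "Q 2 t = 0" "q 1 t = dev D 1" if "t \<in> {\<tau><..m}" for t
    using scheme that unfolding mode2_scheme_def m_def p_def by blast+
  have slot2: "Q 1 t = 0" "Q 2 t = p" "q 2 t = dev D 2" if "t \<in> {m<..T}" for t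
    using scheme that unfolding mode2_scheme_def m_def p_def by blast+
  have slots: "t \<in> {\<tau><..m} \<or> t \<in> {m<..T}" if "t \<in> {\<tau><..T}" for t using that by auto
  have Qint: "(Q k has_integral E) {\<tau><..T}" if "k \<in> {1, 2}" for k
    using that has_integral_two_step_Ioc[OF m(1,2), of "Q 1" p 0] slot1 slot2
      has_integral_two_step_Ioc[OF m(1,2), of "Q 2" 0 p] p(2) unfolding m(3,4) by auto
  \<comment> \<open>The transmitting device has its UAV overhead and no interference, which gives
    \<open>L\<close>; the silent one has rate \<open>log 2 1 = 0\<close> wherever its UAV
    is.\<close>
  have r1: "inst_rate H D \<beta> \<sigma> Q q 1 t = L" "inst_rate H D \<beta> \<sigma> Q q 2 t = 0"
    if "t \<in> {\<tau><..m}" for t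
    using slot1[OF that] unfolding inst_rate_def L_def by (simp_all add: mult_ac)
  have r2: "inst_rate H D \<beta> \<sigma> Q q 1 t = 0" "inst_rate H D \<beta> \<sigma> Q q 2 t = L"
    if "t \<in> {m<..T}" for t
    using slot2[OF that] unfolding inst_rate_def L_def by (simp_all add: mult_ac)
  have rint: "(inst_rate H D \<beta> \<sigma> Q q k has_integral (T - \<tau>) / 2 * L) {\<tau><..T}"
    if "k \<in> {1, 2}" for k
    using that has_integral_two_step_Ioc[OF m(1,2), of "inst_rate H D \<beta> \<sigma> Q q 1" L 0] r1 r2
      has_integral_two_step_Ioc[OF m(1,2), of "inst_rate H D \<beta> \<sigma> Q q 2" 0 L]
    unfolding m(3,4) by auto
  have rate: "rate H D \<beta> \<sigma> T \<tau> Q q k = R_TDMA H \<beta> \<sigma> T \<tau> E" if "k \<in> {1, 2}" for k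
    unfolding rate_def integral_unique[OF rint[OF that]] R_TDMA_def L_def p_def by simp
  then show "\<forall>k\<in>{1,2}. rate H D \<beta> \<sigma> T \<tau> Q q k = R_TDMA H \<beta> \<sigma> T \<tau> E" by blast
  have Qval: "Q k t \<in> {0, p}" if "k \<in> {1, 2}" "t \<in> {\<tau><..T}" for k t
    using that slots[OF that(2)] slot1[of t] slot2[of t] by auto
  have dist: "dmin\<^sup>2 \<le> (norm (q 1 t - q 2 t))\<^sup>2" if "t \<in> {\<tau><..T}" for t
    using scheme that unfolding mode2_scheme_def by blast
  have "0 \<le> Q k t" if "k \<in> {1, 2}" "t \<in> {\<tau><..T}" for k t
    using Qval[OF that] p(1) by auto
  then have feas: "feasible H D \<beta> \<sigma> dmin T \<tau> E Q q (R_TDMA H \<beta> \<sigma> T \<tau> E)"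
    unfolding feasible_def using Qint rint rate dist by (simp add: has_integral_iff)
  have "Q k t \<noteq> 0 \<longrightarrow> q k t = dev D k" if "k \<in> {1, 2}" "t \<in> {\<tau><..T}" for k t
    using that slots[OF that(2)] slot1[of t] slot2[of t] by auto
  moreover have "Q 1 t = 0 \<or> Q 2 t = 0" if "t \<in> {\<tau><..T}" for t
    using slots[OF that] slot1[of t] slot2[of t] by blast
  ultimately have mode: "mode2 T \<tau> Q q"
    unfolding mode2_def binary_power_def using Qval p(1) by blast
  show "solution_in mode2 H D \<beta> \<sigma> dmin T \<tau> E Q q (R_TDMA H \<beta> \<sigma> T \<tau> E)"
    unfolding solution_in_def using mode feas mode2_upper_bound[OF assms(1-6)] by blast
qed

theorem proposition3p1:
  fixes H D \<beta> \<sigma> dmin T \<tau> E :: real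
  assumes "H > 0" and "D > 0" and "\<beta> > 0" and "\<sigma> > 0" and "dmin \<ge> 0"
    and "0 \<le> \<tau>" and "\<tau> < T" and "E > 0"
  shows
    "(\<exists>!x. mode1_optimal_x H D \<beta> \<sigma> dmin T \<tau> E x) \<and>
     (\<forall>x. mode1_optimal_x H D \<beta> \<sigma> dmin T \<tau> E x \<longleftrightarrow>
        x < 0 \<and> mode1_range H D dmin x \<and>
        (mode1_equation H D \<beta> \<sigma> T \<tau> E x \<or>
         \<bar>x\<bar> = dmin / 2 \<and>
         \<not> (\<exists>y<0. mode1_range H D dmin y \<and> mode1_equation H D \<beta> \<sigma> T \<tau> E y))) \<and>
     (\<forall>x Q q. mode1_optimal_x H D \<beta> \<sigma> dmin T \<tau> E x \<and> mode1_scheme T \<tau> E x Q q \<longrightarrow>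
        (\<forall>k\<in>{1,2}. rate H D \<beta> \<sigma> T \<tau> Q q k = R_ST H D \<beta> \<sigma> T \<tau> E x k \<and>
           solution_in mode1 H D \<beta> \<sigma> dmin T \<tau> E Q q (R_ST H D \<beta> \<sigma> T \<tau> E x k))) \<and>
     (\<exists>Q q. mode2_scheme D dmin T \<tau> E Q q) \<and>
     (\<forall>Q q. mode2_scheme D dmin T \<tau> E Q q \<longrightarrow>
        (\<forall>k\<in>{1,2}. rate H D \<beta> \<sigma> T \<tau> Q q k = R_TDMA H \<beta> \<sigma> T \<tau> E) \<and>
        solution_in mode2 H D \<beta> \<sigma> dmin T \<tau> E Q q (R_TDMA H \<beta> \<sigma> T \<tau> E))"
proof (intro conjI)
  show "\<exists>!x. mode1_optimal_x H D \<beta> \<sigma> dmin T \<tau> E x"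
    using mode1_optimal_x_characterization[OF assms] ..
qed (use mode1_optimal_x_characterization[OF assms] in \<open>elim conjunct2\<close>,
    use mode1_scheme_solution[OF assms] in blast, rule mode2_scheme_exists,
    use mode2_scheme_solution[OF assms(1,3,4,6,7,8)] in blast)

end
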